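(* Let $\mathbf{P}$ be a compact interval, with $\overline{\operatorname{int}\mathbf{P}}=\mathbf{P}\neq\emptyset$, contained in $(0,1)\cup(1,\infty)$. Let $N\ge 1$ and $$A=\begin{pmatrix}0&-1\\1&0\end{pmatrix},\qquad b=\begin{pmatrix}1\\0\end{pmatrix},\qquad c=\begin{pmatrix}0&1\end{pmatrix},$$ let $\mathcal{K}_{\mathrm{ring}}(\theta)\in\mathbb{R}^{N\times N}$ be the circulant matrix whose $(i,j)$ entry is $\theta$ if $j\equiv i+1 \pmod N$ and $0$ otherwise, and let $e_1=(1,0,\ldots,0)^\top\in\mathbb{R}^N$. Consider the circular network ensemble of harmonic oscillators $$\tfrac{\partial}{\partial t}x(t,\theta)=\big(I\otimes A+\mathcal{K}_{\mathrm{ring}}(\theta)\otimes bc\big)x(t,\theta)+(e_1\otimes b)u(t),\qquad x(0,\theta)=x_0\in\mathbb{R}^{2N},\quad\theta\in\mathbf{P}.$$ For every $x^*\in C(\mathbf{P},\mathbb{R}^2)$, this ensemble is robustly synchronizable to $\mathbf{1}\otimes x^*$, for every initial state $x_0\in\mathbb{R}^{2N}$.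
   Context: $\mathbf{1}=(1,\ldots,1)^\top\in\mathbb{R}^N$, $\otimes$ is the Kronecker product, and $I$ is the $N\times N$ identity matrix. For an input $u$, $\varphi(T,\mathcal{K}_{\mathrm{ring}}(\theta),x_0,u)$ denotes the solution at time $T$ of the system $$\tfrac{\partial}{\partial t}x(t,\theta)=\big(I\otimes A+\mathcal{K}_{\mathrm{ring}}(\theta)\otimes bc\big)x(t,\theta)+(e_1\otimes b)u(t),\qquad x(0,\theta)=x_0,$$ with initial state $x_0\in\mathbb{R}^{2N}$ (independent of $\theta$). The ensemble is robustly synchronizable (to the target $\mathbf{1}\otimes x^*$) if for every $\varepsilon>0$ there exist $T>0$ and an input $u\in L^1([0,T],\mathbb{R})$, independent of $\theta$ (but allowed to depend on $x_0$ and $x^*$), such that $$\sup_{\theta\in\mathbf{P}}\|\varphi(T,\mathcal{K}_{\mathrm{ring}}(\theta),x_0,u)-(\mathbf{1}\otimes x^*(\theta))\|<\varepsilon.$$ *)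

theory Defs
  imports "HOL-Analysis.Analysis" "HOL-Number_Theory.Cong"
begin

text \<open>
  Rows and columns of Kronecker products are indexed by pairs, so \<open>\<real>\<^bsup>Np\<^esup>\<close> is rendered as
  \<^typ>\<open>real ^ ('n \<times> 'p)\<close>, with node index first; its norm is the Euclidean one.
\<close>

definition kron_mat :: "real ^ 'n ^ 'm \<Rightarrow> real ^ 'q ^ 'p \<Rightarrow> real ^ ('n \<times> 'q) ^ ('m \<times> 'p)"
    (infixr "\<otimes>\<^sub>M" 75) where
  "A \<otimes>\<^sub>M B = (\<chi> i j. A $ fst i $ fst j * B $ snd i $ snd j)"

definition kron_vec :: "real ^ 'n \<Rightarrow> real ^ 'p \<Rightarrow> real ^ ('n \<times> 'p)"
    (infixr "\<otimes>\<^sub>V" 75) where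
  "v \<otimes>\<^sub>V w = (\<chi> i. v $ fst i * w $ snd i)"

definition network_matrix ::
    "real ^ 'p ^ 'p \<Rightarrow> real ^ 'p \<Rightarrow> real ^ 'p \<Rightarrow> real ^ 'n ^ 'n \<Rightarrow> real ^ ('n \<times> 'p) ^ ('n \<times> 'p)" where
  "network_matrix A b c K =
     mat 1 \<otimes>\<^sub>M A + K \<otimes>\<^sub>M ((columnvector b :: real ^ 1 ^ 'p) ** (rowvector c :: real ^ 'p ^ 1))"

text \<open>
  Solutions of \<open>x' = M x + u(t) h\<close>, \<open>x(0) = x\<^sub>0\<close> on \<open>[0,T]\<close>. Inputs are merely
  integrable, so solutions are meant in the sense of Caratheodory, i.e. as continuous solutions
  of the integrated equation; \<open>t = 0\<close> gives the initial condition.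
\<close>

definition solves_on ::
    "real \<Rightarrow> real ^ 'k ^ 'k \<Rightarrow> real ^ 'k \<Rightarrow> real ^ 'k \<Rightarrow> (real \<Rightarrow> real) \<Rightarrow> (real \<Rightarrow> real ^ 'k) \<Rightarrow> bool" where
  "solves_on T M h x0 u x \<longleftrightarrow>
     continuous_on {0..T} x \<and>
     (\<forall>t\<in>{0..T}. ((\<lambda>s. M *v x s + u s *\<^sub>R h) has_integral (x t - x0)) {0..t})"

lemma solves_on_unique:
  fixes M :: "real ^ 'k ^ 'k"
  assumes x: "solves_on T M h x0 u x" and y: "solves_on T M h x0 u y" and t: "t \<in> {0..T}"
  shows "x t = y t"
proof -
  define d where "d = (\<lambda>s. x s - y s)"
  define K where "K = onorm (\<lambda>v. M *v v)"
  have cont: "continuous_on {0..T} d"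
    using x y by (auto simp: solves_on_def d_def intro!: continuous_intros)
  have contM: "continuous_on {0..T} (\<lambda>s. M *v d s)"
    using cont by (intro bounded_linear.continuous_on[OF matrix_vector_mul_bounded_linear])
  have int: "((\<lambda>s. M *v d s) has_integral d r) {0..r}" if "r \<in> {0..T}" for r
  proof -
    have "((\<lambda>s. (M *v x s + u s *\<^sub>R h) - (M *v y s + u s *\<^sub>R h))
             has_integral ((x r - x0) - (y r - x0))) {0..r}"
      using x y that by (intro has_integral_diff) (auto simp: solves_on_def)
    then show ?thesis
      by (simp add: d_def matrix_vector_mult_diff_distrib)
  qed
  have d0: "d 0 = 0"
    using integral_unique[OF int[of 0]] t by simp
  have deriv: "(d has_vector_derivative M *v d r) (at r within {0..T})" if "r \<in> {0..T}" for r
  proof -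
    have "((\<lambda>r. integral {0..r} (\<lambda>s. M *v d s)) has_vector_derivative M *v d r)
            (at r within {0..T})"
      by (rule integral_has_vector_derivative[OF contM that])
    moreover have "integral {0..r} (\<lambda>s. M *v d s) = d r" if "r \<in> {0..T}" for r
      using int[OF that] by (rule integral_unique)
    ultimately show ?thesis
      using that by (metis (no_types, lifting) has_vector_derivative_transform)
  qed
  define g where "g = (\<lambda>r. exp (- 2 * K * r) * (d r \<bullet> d r))"
  define g' where "g' = (\<lambda>r. exp (- 2 * K * r) * (2 * (d r \<bullet> (M *v d r)) - 2 * K * (d r \<bullet> d r)))"
  have gder: "(g has_derivative (\<lambda>v. v * g' r)) (at r within {0..T})" if "r \<in> {0..T}" for r
    unfolding g_def g'_def
    by (rule derivative_eq_intros refl deriv[OF that, unfolded has_vector_derivative_def])+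
       (auto simp: algebra_simps inner_commute)
  have g'_le: "g' r \<le> 0" for r
  proof -
    have "d r \<bullet> (M *v d r) \<le> norm (d r) * norm (M *v d r)"
      by (rule norm_cauchy_schwarz)
    also have "\<dots> \<le> norm (d r) * (K * norm (d r))"
      unfolding K_def by (intro mult_left_mono onorm matrix_vector_mul_bounded_linear norm_ge_zero)
    also have "\<dots> = K * (d r \<bullet> d r)"
      by (simp add: power2_norm_eq_inner[symmetric] power2_eq_square)
    finally show ?thesis
      unfolding g'_def by (intro mult_nonneg_nonpos) auto
  qed
  have "\<exists>r\<in>{0..t}. g t - g 0 = (t - 0) * g' r"
    using t by (intro mvt_very_simple) (auto intro!: has_derivative_subset[OF gder])
  then obtain r where "g t - g 0 = t * g' r"
    by auto
  moreover have "t * g' r \<le> 0"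
    using t g'_le[of r] by (intro mult_nonneg_nonpos) auto
  ultimately have "g t \<le> g 0"
    by linarith
  then have "d t \<bullet> d t \<le> 0"
    by (simp add: g_def d0 mult_le_0_iff)
  then have "d t = 0"
    by (metis inner_eq_zero_iff inner_ge_zero order_antisym)
  then show ?thesis
    by (simp add: d_def)
qed

text \<open>
  For each parameter \<open>\<theta>\<close>, \<open>x \<theta>\<close> below is the solution for the input \<open>u\<close> (it is unique by
  \<open>solves_on_unique\<close>), and \<open>x \<theta> T\<close> is the state it reaches at time \<open>T\<close>. As \<open>SUP\<close> over an
  unbounded set of reals is unspecified, boundedness is required explicitly.
\<close>

definition robustly_synchronizable ::
    "real set \<Rightarrow> real ^ 'p ^ 'p \<Rightarrow> real ^ 'p \<Rightarrow> real ^ 'p \<Rightarrow> (real \<Rightarrow> real ^ 'n ^ 'n) \<Rightarrow> real ^ 'n \<Rightarrow>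
     real ^ ('n \<times> 'p) \<Rightarrow> (real \<Rightarrow> real ^ 'p) \<Rightarrow> bool" where
  "robustly_synchronizable P A b c K e x0 xstar \<longleftrightarrow>
     (\<forall>\<epsilon>>0. \<exists>T>0. \<exists>u. u absolutely_integrable_on {0..T} \<and>
        (\<exists>x. (\<forall>\<theta>\<in>P. solves_on T (network_matrix A b c (K \<theta>)) (e \<otimes>\<^sub>V b) x0 u (x \<theta>)) \<and>
             bdd_above ((\<lambda>\<theta>. norm (x \<theta> T - (1 \<otimes>\<^sub>V xstar \<theta>))) ` P) \<and>
             (SUP \<theta>\<in>P. norm (x \<theta> T - (1 \<otimes>\<^sub>V xstar \<theta>))) < \<epsilon>))"

definition osc_A :: "real ^ 2 ^ 2" where
  "osc_A = vector [vector [0, -1], vector [1, 0]]"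

definition osc_b :: "real ^ 2" where
  "osc_b = vector [1, 0]"

definition osc_c :: "real ^ 2" where
  "osc_c = vector [0, 1]"

text \<open>
  The \<open>N\<close> nodes are the elements of a finite type \<^typ>\<open>'n\<close>, and \<open>idx\<close> is a numbering of them by
  \<open>1, \<dots>, N\<close>. For \<open>N = 1\<close> the coupling matrix is \<open>(\<theta>)\<close>.
\<close>

definition K_ring :: "('n::finite \<Rightarrow> nat) \<Rightarrow> real \<Rightarrow> real ^ 'n ^ 'n" where
  "K_ring idx \<theta> = (\<chi> i j. if [idx j = idx i + 1] (mod CARD('n)) then \<theta> else 0)"

definition e_first :: "('n::finite \<Rightarrow> nat) \<Rightarrow> real ^ 'n" where
  "e_first idx = (\<chi> i. if idx i = 1 then 1 else 0)"

end

theory Submission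
  imports Defs
begin

text \<open>
  Let \<open>M\<close> be the system matrix, \<open>h = e\<^sub>1 \<otimes> b\<close> and \<open>S\<close> the cyclic shift. As
  \<open>M\<^sup>2 + I = \<theta> S \<otimes> I\<close> and \<open>M h = e\<^sub>1 \<otimes> (0, 1)\<close>, the vectors obtained from \<open>h\<close> by
  polynomials in \<open>M\<close> are spanned by \<open>\<theta>\<^sup>k S\<^sup>k e\<^sub>1 \<otimes> v\<close>. In each component this leaves
  the functions \<open>\<theta>\<^sup>m p(\<theta>\<^sup>N)\<close> with \<open>p\<close> an arbitrary polynomial, and they are uniformly dense
  in \<open>C(P)\<close> by Weierstrass, since \<open>\<theta> > 0\<close> is recovered from \<open>\<theta>\<^sup>N\<close>. The functions
  \<open>\<theta> \<mapsto> M(\<theta>)\<^sup>k h\<close> themselves are uniform limits of states reached from rest: the response to a step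
  input switched on at time \<open>T - t\<close> is \<open>F(t) = \<Sum>k. t\<^sup>k\<^sup>+\<^sup>1 M\<^sup>k h / (k+1)!\<close>, and the derivatives of \<open>F\<close>
  at \<open>0\<close>, limits of difference quotients, are exactly the vectors \<open>M\<^sup>k h\<close>.
\<close>

section \<open>Power series with factorial weights and vector coefficients\<close>

text \<open>The coefficients are kept arbitrary, so that differentiation becomes a shift of the
  sequence. The choice \<open>a k = M^k x0\<close> gives the matrix exponential applied to
  \<open>x0\<close>; the response to a step input is another instance. A geometric bound
  \<open>C * K ^ k\<close> on the coefficients is the recurring hypothesis, with the real
  exponential series as majorant.\<close>

definition exp_series :: "(nat \<Rightarrow> 'a::banach) \<Rightarrow> real \<Rightarrow> 'a" where
  "exp_series a t = (\<Sum>k. (t ^ k / fact k) *\<^sub>R a k)"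

lemma exp_series_term_bound:
  fixes a :: "nat \<Rightarrow> 'a::banach"
  assumes "norm (a k) \<le> C * K ^ k" and "\<bar>t\<bar> \<le> R"
  shows "norm ((t ^ k / fact k) *\<^sub>R a k) \<le> C * ((R * K) ^ k / fact k)"
proof -
  have "norm ((t ^ k / fact k) *\<^sub>R a k) = \<bar>t\<bar> ^ k / fact k * norm (a k)"
    by (simp add: power_abs)
  also have "\<dots> \<le> R ^ k / fact k * (C * K ^ k)"
    using assms by (intro mult_mono divide_right_mono power_mono) auto
  finally show ?thesis
    by (simp add: power_mult_distrib mult_ac)
qed

lemma summable_exp_real: "summable (\<lambda>k. C * ((x::real) ^ k / fact k))"
  using summable_exp[of x] by (intro summable_mult) (simp add: field_simps)

lemma suminf_exp_real: "(\<Sum>k. C * ((x::real) ^ k / fact k)) = C * exp x"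
  using summable_exp[of x] by (subst suminf_mult) (simp_all add: exp_def field_simps)

lemma summable_exp_series:
  fixes a :: "nat \<Rightarrow> 'a::banach"
  assumes "\<And>k. norm (a k) \<le> C * K ^ k"
  shows "summable (\<lambda>k. (t ^ k / fact k) *\<^sub>R a k)"
proof (rule summable_comparison_test[OF _ summable_exp_real], intro exI allI impI)
  fix k :: nat
  show "norm ((t ^ k / fact k) *\<^sub>R a k) \<le> C * ((\<bar>t\<bar> * K) ^ k / fact k)"
    by (rule exp_series_term_bound[OF assms order_refl])
qed

lemma norm_exp_series_le:
  fixes a :: "nat \<Rightarrow> 'a::banach"
  assumes "\<And>k. norm (a k) \<le> C * K ^ k" and "\<bar>t\<bar> \<le> R"
  shows "norm (exp_series a t) \<le> C * exp (R * K)"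
proof -
  have "norm (exp_series a t) \<le> (\<Sum>k. C * ((R * K) ^ k / fact k))"
    unfolding exp_series_def
    by (intro norm_suminf_le exp_series_term_bound assms summable_exp_real)
  then show ?thesis
    by (simp only: suminf_exp_real)
qed

lemma exp_series_0 [simp]: "exp_series a 0 = a 0"
proof -
  have "(\<lambda>k. (0 ^ k / fact k) *\<^sub>R a k) = (\<lambda>k. if k = 0 then a 0 else 0)"
    by (auto simp: fun_eq_iff)
  then have "exp_series a 0 = (\<Sum>k. if k = 0 then a 0 else 0)"
    by (simp add: exp_series_def)
  also have "\<dots> = a 0"
    by (subst suminf_finite[of "{0}"]) auto
  finally show ?thesis .
qed

lemma exp_series_matrix:
  fixes M :: "real ^ 'k ^ 'k"
  assumes "\<And>k. norm (a k) \<le> C * K ^ k"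
  shows "exp_series (\<lambda>k. M *v a k) t = M *v exp_series a t"
  unfolding exp_series_def
  by (subst bounded_linear.suminf[OF matrix_vector_mul_bounded_linear summable_exp_series[OF assms]])
     (simp add: scaleR_matrix_vector_assoc matrix_scaleR_vector_ac)

lemma norm_shift_le:
  fixes a :: "nat \<Rightarrow> 'a::banach"
  assumes "\<And>k. norm (a k) \<le> C * K ^ k"
  shows "norm (a (k + j)) \<le> (C * K ^ j) * K ^ k"
  using assms[of "k + j"] by (simp add: power_add mult_ac)

text \<open>Termwise differentiation is justified on a bounded open interval around
  \<open>t\<close>, where the differentiated series converges uniformly by the M-test.\<close>

lemma exp_series_has_vector_derivative:
  fixes a :: "nat \<Rightarrow> 'a::banach"
  assumes a: "\<And>k. norm (a k) \<le> C * K ^ k"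
  shows "(exp_series a has_vector_derivative exp_series (\<lambda>k. a (Suc k)) t) (at t)"
proof -
  define R where "R = \<bar>t\<bar> + 1"
  define S where "S = {-R<..<R}"
  define f where "f = (\<lambda>k x. (x ^ k / fact k) *\<^sub>R a k)"
  define f' where "f' = (\<lambda>k x. (real k * x ^ (k - 1) / fact k) *\<^sub>R a k)"
  define g' where "g' = exp_series (\<lambda>k. a (Suc k))"
  have t: "t \<in> S" "open S"
    by (auto simp: S_def R_def)
  have a': "norm (a (Suc k)) \<le> (C * K) * K ^ k" for k
    using norm_shift_le[OF a, of k 1] by simp
  have f'_Suc: "f' (Suc k) = (\<lambda>x. (x ^ k / fact k) *\<^sub>R a (Suc k))" for k
    by (auto simp: f'_def fun_eq_iff field_simps simp del: of_nat_Suc)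
  have unif: "uniform_limit S (\<lambda>n x. \<Sum>i<n. f' (Suc i) x) g' sequentially"
    unfolding f'_Suc g'_def exp_series_def
    by (rule Weierstrass_m_test[OF _ summable_exp_real[of "C * K" "R * K"]],
        rule exp_series_term_bound[OF a']) (auto simp: S_def)
  \<comment> \<open>The differentiated term of index 0 vanishes, so dropping it shifts the partial
    sums by one index.\<close>
  have sum_f': "(\<Sum>i<Suc n. f' i x) = (\<Sum>i<n. f' (Suc i) x)" for n x
    by (subst sum.lessThan_Suc_shift) (simp add: f'_def)
  have "\<exists>g. \<forall>x\<in>S. (\<lambda>n. f n x) sums (g x) \<and>
          (g has_derivative (\<lambda>h. h *\<^sub>R g' x)) (at x within S)"
  proof (rule has_derivative_series[where f' = "\<lambda>n x h. h *\<^sub>R f' n x"])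
    show "convex S"
      by (simp add: S_def)
    show "((f n) has_derivative (\<lambda>h. h *\<^sub>R f' n x)) (at x within S)" for n x
      unfolding f_def f'_def
      by (rule derivative_eq_intros refl)+ (auto simp: field_simps)
    show "\<forall>\<^sub>F n in sequentially. \<forall>x\<in>S. \<forall>h. norm ((\<Sum>i<n. h *\<^sub>R f' i x) - h *\<^sub>R g' x) \<le> e * norm h"
      if "e > 0" for e :: real
    proof -
      have "\<forall>\<^sub>F n in sequentially. \<forall>x\<in>S. dist (\<Sum>i<n. f' (Suc i) x) (g' x) < e"
        using unif that by (rule uniform_limitD)
      then have "\<forall>\<^sub>F n in sequentially. \<forall>x\<in>S. norm ((\<Sum>i<Suc n. f' i x) - g' x) < e"
        by (simp only: sum_f' dist_norm)
      then have "\<forall>\<^sub>F n in sequentially. \<forall>x\<in>S. norm ((\<Sum>i<n. f' i x) - g' x) < e"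
        by (rule eventually_sequentially_Suc[THEN iffD1])
      then show ?thesis
      proof eventually_elim
        case (elim n)
        have "norm ((\<Sum>i<n. h *\<^sub>R f' i x) - h *\<^sub>R g' x) = norm ((\<Sum>i<n. f' i x) - g' x) * norm h"
          for x h
          by (simp add: scaleR_right.sum[symmetric] scaleR_diff_right[symmetric])
        with elim show ?case
          by (metis less_imp_le mult_right_mono norm_ge_zero)
      qed
    qed
    show "t \<in> S" by fact
    show "(\<lambda>n. f n t) sums exp_series a t"
      unfolding f_def exp_series_def by (rule summable_sums[OF summable_exp_series[OF a]])
  qed
  then obtain g where g: "\<And>x. x \<in> S \<Longrightarrow> (\<lambda>n. f n x) sums (g x)"
      "\<And>x. x \<in> S \<Longrightarrow> (g has_derivative (\<lambda>h. h *\<^sub>R g' x)) (at x within S)"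
    by blast
  have "g x = exp_series a x" if "x \<in> S" for x
    using g(1)[OF that] by (simp add: f_def exp_series_def sums_iff)
  moreover have "(g has_vector_derivative g' t) (at t)"
    using g(2)[OF t(1)] t by (simp add: has_vector_derivative_def at_within_open[of t S])
  ultimately show ?thesis
    unfolding g'_def using t has_vector_derivative_transform_within_open[of g _ t S] by blast
qed

text \<open>The constant depends on the sequence only through \<^term>\<open>C\<close> and \<^term>\<open>K\<close>, which makes
  difference quotients converge uniformly in a parameter.\<close>

lemma exp_series_difference_quotient:
  fixes a :: "nat \<Rightarrow> 'a::banach"
  assumes a: "\<And>k. norm (a k) \<le> C * K ^ k" and t: "0 \<le> t" "0 < d" "t + d \<le> R"
  shows "norm ((1 / d) *\<^sub>R (exp_series a (t + d) - exp_series a t) - exp_series (\<lambda>k. a (Suc k)) t)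
           \<le> d * (C * K ^ 2 * exp (R * K))"
proof -
  \<comment> \<open>\<open>B\<close> bounds the second derivative on \<open>{t..t+d}\<close>. Hence
    the first derivative varies there by at most \<open>d * B\<close>, and the linearization error
    over a step \<open>d\<close> is at most \<open>d * (d * B)\<close>.\<close>
  define B where "B = C * K ^ 2 * exp (R * K)"
  have a1: "norm (a (Suc k)) \<le> (C * K) * K ^ k" for k
    using norm_shift_le[OF a, of k 1] by simp
  have a2: "norm (a (Suc (Suc k))) \<le> (C * K ^ 2) * K ^ k" for k
    using norm_shift_le[OF a, of k 2] by simp
  have d1: "norm (exp_series (\<lambda>k. a (Suc k)) s - exp_series (\<lambda>k. a (Suc k)) t) \<le> d * B"
    if s: "s \<in> {t..t+d}" for s
  proof -
    have "norm (exp_series (\<lambda>k. a (Suc k)) s - exp_series (\<lambda>k. a (Suc k)) t) \<le> B * norm (s - t)"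
    proof (rule differentiable_bound)
      fix x assume "x \<in> {t..t+d}"
      show "(exp_series (\<lambda>k. a (Suc k)) has_derivative
              (\<lambda>h. h *\<^sub>R exp_series (\<lambda>k. a (Suc (Suc k))) x)) (at x within {t..t+d})"
        using exp_series_has_vector_derivative[OF a1, of x]
        by (auto simp: has_vector_derivative_def intro: has_derivative_at_withinI)
      have "norm (exp_series (\<lambda>k. a (Suc (Suc k))) x) \<le> B"
        unfolding B_def using \<open>x \<in> _\<close> t by (intro norm_exp_series_le[OF a2]) auto
      then show "onorm (\<lambda>h. h *\<^sub>R exp_series (\<lambda>k. a (Suc (Suc k))) x) \<le> B"
        by (intro onorm_le) (simp add: mult.commute[of B] mult_left_mono)
    qed (use s t in auto)
    also have "\<dots> \<le> B * d"
    proof (rule mult_left_mono)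
      show "0 \<le> B"
        unfolding B_def using t
        by (intro order_trans[OF norm_ge_zero norm_exp_series_le[OF a2, of t R]]) auto
    qed (use s in auto)
    finally show ?thesis
      by (simp add: mult.commute)
  qed
  have "norm (exp_series a (t + d) - exp_series a t - (t + d - t) *\<^sub>R exp_series (\<lambda>k. a (Suc k)) t)
      \<le> norm (t + d - t) * (d * B)"
    by (rule vector_differentiable_bound_linearization[where S = "{t..t+d}"])
       (use t d1 in \<open>auto simp: closed_segment_eq_real_ivl
          intro!: has_vector_derivative_at_within exp_series_has_vector_derivative[OF a]\<close>)
  then have *: "norm (exp_series a (t + d) - exp_series a t - d *\<^sub>R exp_series (\<lambda>k. a (Suc k)) t)
      \<le> d * (d * B)"
    using t by simp
  have "(1 / d) *\<^sub>R (exp_series a (t + d) - exp_series a t) - exp_series (\<lambda>k. a (Suc k)) t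
      = (1 / d) *\<^sub>R (exp_series a (t + d) - exp_series a t - d *\<^sub>R exp_series (\<lambda>k. a (Suc k)) t)"
    using t by (simp add: scaleR_diff_right)
  with * t show ?thesis
    by (simp add: B_def divide_simps mult_ac)
qed

section \<open>Superposition, free motion and step responses\<close>

lemma solves_on_add:
  assumes "solves_on T M h x0 u x" and "solves_on T M h y0 v y"
  shows "solves_on T M h (x0 + y0) (\<lambda>s. u s + v s) (\<lambda>s. x s + y s)"
  unfolding solves_on_def
proof (intro conjI ballI)
  show "continuous_on {0..T} (\<lambda>s. x s + y s)"
    using assms by (auto simp: solves_on_def intro!: continuous_intros)
  fix t assume "t \<in> {0..T}"
  then have "((\<lambda>s. (M *v x s + u s *\<^sub>R h) + (M *v y s + v s *\<^sub>R h)) has_integral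
      (x t - x0) + (y t - y0)) {0..t}"
    using assms by (intro has_integral_add) (auto simp: solves_on_def)
  then show "((\<lambda>s. M *v (x s + y s) + (u s + v s) *\<^sub>R h) has_integral
      x t + y t - (x0 + y0)) {0..t}"
    by (simp add: algebra_simps matrix_vector_right_distrib)
qed

lemma solves_on_scaleR:
  assumes "solves_on T M h x0 u x"
  shows "solves_on T M h (c *\<^sub>R x0) (\<lambda>s. c * u s) (\<lambda>s. c *\<^sub>R x s)"
  unfolding solves_on_def
proof (intro conjI ballI)
  show "continuous_on {0..T} (\<lambda>s. c *\<^sub>R x s)"
    using assms by (auto simp: solves_on_def intro!: continuous_intros)
  fix t assume "t \<in> {0..T}"
  then have "((\<lambda>s. c *\<^sub>R (M *v x s + u s *\<^sub>R h)) has_integral c *\<^sub>R (x t - x0)) {0..t}"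
    using assms by (intro has_integral_cmul) (auto simp: solves_on_def)
  then show "((\<lambda>s. M *v (c *\<^sub>R x s) + (c * u s) *\<^sub>R h) has_integral
      c *\<^sub>R x t - c *\<^sub>R x0) {0..t}"
    by (simp add: algebra_simps matrix_scaleR_vector_ac scaleR_matrix_vector_assoc)
qed

lemma norm_iterate_le:
  fixes M :: "real ^ 'k ^ 'k"
  assumes "\<And>v. norm (M *v v) \<le> K * norm v" and "0 \<le> K"
  shows "norm (((*v) M ^^ k) v) \<le> norm v * K ^ k"
proof (induction k)
  case (Suc k)
  have "norm (((*v) M ^^ Suc k) v) \<le> K * norm (((*v) M ^^ k) v)"
    using assms(1) by simp
  also have "\<dots> \<le> K * (norm v * K ^ k)"
    using Suc assms(2) by (rule mult_left_mono)
  finally show ?case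
    by (simp add: mult_ac)
qed simp

lemma solves_on_free:
  fixes M :: "real ^ 'k ^ 'k"
  assumes M: "\<And>v. norm (M *v v) \<le> K * norm v" and "0 \<le> K"
  shows "solves_on T M h x0 (\<lambda>_. 0) (exp_series (\<lambda>k. ((*v) M ^^ k) x0))"
proof -
  let ?a = "\<lambda>k. ((*v) M ^^ k) x0"
  note a = norm_iterate_le[OF assms, of _ x0]
  have deriv: "(exp_series ?a has_vector_derivative M *v exp_series ?a t) (at t within S)" for t S
    using exp_series_has_vector_derivative[OF a, of t] exp_series_matrix[OF a, of M t]
    by (auto intro: has_vector_derivative_at_within)
  show ?thesis
    unfolding solves_on_def
  proof (intro conjI ballI)
    show "continuous_on {0..T} (exp_series ?a)"
      using deriv by (auto intro!: has_vector_derivative_continuous simp: continuous_on_eq_continuous_within)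
    fix t assume "t \<in> {0..T}"
    then show "((\<lambda>s. M *v exp_series ?a s + 0 *\<^sub>R h) has_integral exp_series ?a t - x0) {0..t}"
      using fundamental_theorem_of_calculus[of 0 t "exp_series ?a", OF _ deriv] by simp
  qed
qed

text \<open>The Taylor coefficients of \<open>F t = \<Sum>k. t^(k+1) / (k+1)! M^k h\<close>, i.e. of the response
  from rest to the constant input 1.\<close>

definition step_response :: "real ^ 'k ^ 'k \<Rightarrow> real ^ 'k \<Rightarrow> nat \<Rightarrow> real ^ 'k" where
  "step_response M h k = (case k of 0 \<Rightarrow> 0 | Suc k \<Rightarrow> ((*v) M ^^ k) h)"

text \<open>The coefficient of index \<open>k\<close> contains only \<open>k - 1\<close> factors of
  the matrix; \<open>1 \<le> K\<close> lets the spare factor be absorbed, so that the bound has the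
  form required of series coefficients.\<close>

lemma norm_step_response_le:
  fixes M :: "real ^ 'k ^ 'k"
  assumes "\<And>v. norm (M *v v) \<le> K * norm v" and "1 \<le> K"
  shows "norm (step_response M h k) \<le> norm h * K ^ k"
proof (cases k)
  case (Suc n)
  have "norm (step_response M h k) \<le> norm h * K ^ n"
    using norm_iterate_le[OF assms(1), of n h] assms(2) Suc by (simp add: step_response_def)
  also have "\<dots> \<le> norm h * K ^ k"
    using assms(2) Suc by (intro mult_left_mono power_increasing) auto
  finally show ?thesis .
qed (simp add: step_response_def)

lemma exp_series_step_response_deriv:
  fixes M :: "real ^ 'k ^ 'k"
  assumes M: "\<And>v. norm (M *v v) \<le> K * norm v" and K: "1 \<le> K"
  shows "(exp_series (step_response M h) has_vector_derivative
           M *v exp_series (step_response M h) t + h) (at t)"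
proof -
  let ?a = "step_response M h"
  note a = norm_step_response_le[OF assms, of h]
  let ?e = "\<lambda>k. if k = 0 then h else 0 :: real ^ 'k"
  have e: "(\<lambda>k. (t ^ k / fact k) *\<^sub>R ?e k) sums h"
  proof -
    have "(\<lambda>k. (t ^ k / fact k) *\<^sub>R ?e k) = (\<lambda>k. if k = 0 then h else 0)"
      by (auto simp: fun_eq_iff)
    then show ?thesis
      using sums_single[of 0 "\<lambda>_. h"] by simp
  qed
  have Ma: "norm (M *v ?a k) \<le> (K * norm h) * K ^ k" for k
    using order_trans[OF M mult_left_mono[OF a, of K k]] K by (simp add: mult_ac)
  \<comment> \<open>Since \<open>?a 0 = 0\<close> and \<open>?a 1 = h\<close>, the recursion by
    \<open>M\<close> fails only at \<open>k = 0\<close>. The defect is the coefficient sequence of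
    the constant \<open>h\<close>, which becomes the input term of the differential
    equation.\<close>
  have shift: "?a (Suc k) = M *v ?a k + ?e k" for k
    by (cases k) (auto simp: step_response_def)
  have "(\<lambda>k. (t ^ k / fact k) *\<^sub>R ?a (Suc k)) sums (exp_series (\<lambda>k. M *v ?a k) t + h)"
    unfolding shift scaleR_add_right exp_series_def
    by (intro sums_add e summable_sums[OF summable_exp_series[OF Ma]])
  then have "exp_series (\<lambda>k. ?a (Suc k)) t = M *v exp_series ?a t + h"
    unfolding exp_series_matrix[OF a] by (simp add: exp_series_def sums_iff)
  then show ?thesis
    using exp_series_has_vector_derivative[OF a, of t] by simp
qed

text \<open>The state rests until the input is switched on at time \<open>r\<close> and then follows
  the step response with delay \<open>r\<close>. Truncation by \<open>max 0\<close> glues the two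
  phases continuously, because the response starts at 0.\<close>

lemma solves_on_step:
  fixes M :: "real ^ 'k ^ 'k"
  assumes M: "\<And>v. norm (M *v v) \<le> K * norm v" and K: "1 \<le> K" and r: "0 \<le> r"
  shows "solves_on T M h 0 (indicator {r..}) (\<lambda>s. exp_series (step_response M h) (max 0 (s - r)))"
proof -
  let ?F = "exp_series (step_response M h)"
  let ?x = "\<lambda>s. ?F (max 0 (s - r))"
  note deriv = exp_series_step_response_deriv[OF M K, of h]
  have F0: "?F 0 = 0"
    by (simp add: step_response_def)
  have cont_F: "continuous_on UNIV ?F"
    using deriv by (auto intro!: has_vector_derivative_continuous simp: continuous_on_eq_continuous_at)
  have cont: "continuous_on S ?x" for S
    by (rule continuous_on_compose2[OF cont_F]) (auto intro!: continuous_intros)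
  \<comment> \<open>The velocity may jump at \<open>r\<close>; the fundamental theorem of calculus
    tolerates this single exceptional point for a continuous function.\<close>
  have x': "(?x has_vector_derivative M *v ?x s + indicator {r..} s *\<^sub>R h) (at s)" if "s \<noteq> r" for s
  proof (cases "s < r")
    case True
    have "((\<lambda>_. 0) has_vector_derivative M *v ?x s + indicator {r..} s *\<^sub>R h) (at s)"
      using True F0 by simp
    then show ?thesis
      by (rule has_vector_derivative_transform_within_open[of _ _ _ "{..<r}"]) (use True F0 in auto)
  next
    case False
    have "((\<lambda>s. s - r) has_vector_derivative 1) (at s)"
      by (auto intro!: derivative_eq_intros)
    from vector_diff_chain_at[OF this deriv]
    have "((\<lambda>s. ?F (s - r)) has_vector_derivative M *v ?x s + indicator {r..} s *\<^sub>R h) (at s)"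
      using False by (simp add: o_def)
    then show ?thesis
      by (rule has_vector_derivative_transform_within_open[of _ _ _ "{r<..}"]) (use False that in auto)
  qed
  show ?thesis
    unfolding solves_on_def
  proof (intro conjI ballI cont)
    fix t assume "t \<in> {0..T}"
    then show "((\<lambda>s. M *v ?x s + indicator {r..} s *\<^sub>R h) has_integral ?x t - 0) {0..t}"
      using fundamental_theorem_of_calculus_strong[of "{r}" 0 t ?x, OF _ _ x' cont] F0 r
      by auto
  qed
qed

section \<open>Parameter families approximately reachable from rest\<close>

text \<open>Starting from rest makes these families a linear space, closed under uniform convergence
  on \<open>P\<close>. One input serves all parameters, while the trajectory may depend on the
  parameter.\<close>

definition approx_reachable ::
    "real \<Rightarrow> ('p \<Rightarrow> real ^ 'k ^ 'k) \<Rightarrow> real ^ 'k \<Rightarrow> 'p set \<Rightarrow> ('p \<Rightarrow> real ^ 'k) \<Rightarrow> bool" where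
  "approx_reachable T M h P f \<longleftrightarrow>
     (\<forall>\<epsilon>>0. \<exists>u x. u absolutely_integrable_on {0..T} \<and>
        (\<forall>\<theta>\<in>P. solves_on T (M \<theta>) h 0 u (x \<theta>) \<and> norm (x \<theta> T - f \<theta>) < \<epsilon>))"

lemma approx_reachableE:
  assumes "approx_reachable T M h P f" and "\<epsilon> > 0"
  obtains u x where "u absolutely_integrable_on {0..T}"
    and "\<And>\<theta>. \<theta> \<in> P \<Longrightarrow> solves_on T (M \<theta>) h 0 u (x \<theta>)"
    and "\<And>\<theta>. \<theta> \<in> P \<Longrightarrow> norm (x \<theta> T - f \<theta>) < \<epsilon>"
  using assms unfolding approx_reachable_def by meson

lemma approx_reachable_closed:
  assumes "\<And>\<epsilon>. \<epsilon> > 0 \<Longrightarrow> \<exists>g. approx_reachable T M h P g \<and> (\<forall>\<theta>\<in>P. norm (g \<theta> - f \<theta>) < \<epsilon>)"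
  shows "approx_reachable T M h P f"
  unfolding approx_reachable_def
proof (intro allI impI)
  fix \<epsilon> :: real assume "\<epsilon> > 0"
  then obtain g where g: "approx_reachable T M h P g" "\<forall>\<theta>\<in>P. norm (g \<theta> - f \<theta>) < \<epsilon> / 2"
    using assms[of "\<epsilon> / 2"] by auto
  obtain u x where ux: "u absolutely_integrable_on {0..T}"
    "\<And>\<theta>. \<theta> \<in> P \<Longrightarrow> solves_on T (M \<theta>) h 0 u (x \<theta>)"
    "\<And>\<theta>. \<theta> \<in> P \<Longrightarrow> norm (x \<theta> T - g \<theta>) < \<epsilon> / 2"
    using approx_reachableE[OF g(1), of "\<epsilon> / 2"] \<open>\<epsilon> > 0\<close> by auto
  have "norm (x \<theta> T - f \<theta>) < \<epsilon>" if "\<theta> \<in> P" for \<theta>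
    using norm_triangle_ineq[of "x \<theta> T - g \<theta>" "g \<theta> - f \<theta>"] ux(3)[OF that] g(2) that
    by (fastforce simp: algebra_simps)
  with ux show "\<exists>u x. u absolutely_integrable_on {0..T} \<and>
      (\<forall>\<theta>\<in>P. solves_on T (M \<theta>) h 0 u (x \<theta>) \<and> norm (x \<theta> T - f \<theta>) < \<epsilon>)"
    by blast
qed

lemma approx_reachable_add:
  assumes f: "approx_reachable T M h P f" and g: "approx_reachable T M h P g"
  shows "approx_reachable T M h P (\<lambda>\<theta>. f \<theta> + g \<theta>)"
  unfolding approx_reachable_def
proof (intro allI impI)
  fix \<epsilon> :: real assume "\<epsilon> > 0"
  then have "\<epsilon> / 2 > 0" by simp
  obtain u x where ux: "u absolutely_integrable_on {0..T}"
    "\<And>\<theta>. \<theta> \<in> P \<Longrightarrow> solves_on T (M \<theta>) h 0 u (x \<theta>)"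
    "\<And>\<theta>. \<theta> \<in> P \<Longrightarrow> norm (x \<theta> T - f \<theta>) < \<epsilon> / 2"
    using approx_reachableE[OF f \<open>\<epsilon> / 2 > 0\<close>] by metis
  obtain v y where vy: "v absolutely_integrable_on {0..T}"
    "\<And>\<theta>. \<theta> \<in> P \<Longrightarrow> solves_on T (M \<theta>) h 0 v (y \<theta>)"
    "\<And>\<theta>. \<theta> \<in> P \<Longrightarrow> norm (y \<theta> T - g \<theta>) < \<epsilon> / 2"
    using approx_reachableE[OF g \<open>\<epsilon> / 2 > 0\<close>] by metis
  show "\<exists>u x. u absolutely_integrable_on {0..T} \<and>
      (\<forall>\<theta>\<in>P. solves_on T (M \<theta>) h 0 u (x \<theta>) \<and> norm (x \<theta> T - (f \<theta> + g \<theta>)) < \<epsilon>)"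
  proof (intro exI conjI ballI)
    show "(\<lambda>s. u s + v s) absolutely_integrable_on {0..T}"
      using ux(1) vy(1) by (rule set_integral_add(1))
    fix \<theta> assume "\<theta> \<in> P"
    show "solves_on T (M \<theta>) h 0 (\<lambda>s. u s + v s) (\<lambda>s. x \<theta> s + y \<theta> s)"
      using solves_on_add[OF ux(2) vy(2), OF \<open>\<theta> \<in> P\<close> \<open>\<theta> \<in> P\<close>] by simp
    show "norm (x \<theta> T + y \<theta> T - (f \<theta> + g \<theta>)) < \<epsilon>"
      using norm_triangle_ineq[of "x \<theta> T - f \<theta>" "y \<theta> T - g \<theta>"] ux(3)[OF \<open>\<theta> \<in> P\<close>] vy(3)[OF \<open>\<theta> \<in> P\<close>]
      by (simp add: algebra_simps)
  qed
qed

lemma approx_reachable_scaleR: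
  assumes f: "approx_reachable T M h P f"
  shows "approx_reachable T M h P (\<lambda>\<theta>. c *\<^sub>R f \<theta>)"
  unfolding approx_reachable_def
proof (intro allI impI)
  fix \<epsilon> :: real assume "\<epsilon> > 0"
  \<comment> \<open>The summand 1 keeps the divisor positive when \<open>c = 0\<close>.\<close>
  then have "\<epsilon> / (\<bar>c\<bar> + 1) > 0" by simp
  then obtain u x where ux: "u absolutely_integrable_on {0..T}"
    "\<And>\<theta>. \<theta> \<in> P \<Longrightarrow> solves_on T (M \<theta>) h 0 u (x \<theta>)"
    "\<And>\<theta>. \<theta> \<in> P \<Longrightarrow> norm (x \<theta> T - f \<theta>) < \<epsilon> / (\<bar>c\<bar> + 1)"
    using approx_reachableE[OF f] by metis
  show "\<exists>u x. u absolutely_integrable_on {0..T} \<and>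
      (\<forall>\<theta>\<in>P. solves_on T (M \<theta>) h 0 u (x \<theta>) \<and> norm (x \<theta> T - c *\<^sub>R f \<theta>) < \<epsilon>)"
  proof (intro exI conjI ballI)
    show "(\<lambda>s. c * u s) absolutely_integrable_on {0..T}"
      using absolutely_integrable_scaleR_left[OF ux(1), of c] by simp
    fix \<theta> assume "\<theta> \<in> P"
    show "solves_on T (M \<theta>) h 0 (\<lambda>s. c * u s) (\<lambda>s. c *\<^sub>R x \<theta> s)"
      using solves_on_scaleR[OF ux(2)[OF \<open>\<theta> \<in> P\<close>], of c] by simp
    have "norm (c *\<^sub>R x \<theta> T - c *\<^sub>R f \<theta>) = \<bar>c\<bar> * norm (x \<theta> T - f \<theta>)"
      by (simp add: scaleR_diff_right[symmetric])
    also have "\<dots> \<le> (\<bar>c\<bar> + 1) * norm (x \<theta> T - f \<theta>)"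
      by (intro mult_right_mono) auto
    also have "\<dots> < (\<bar>c\<bar> + 1) * (\<epsilon> / (\<bar>c\<bar> + 1))"
      using ux(3)[OF \<open>\<theta> \<in> P\<close>] by (intro mult_strict_left_mono) auto
    also have "\<dots> = \<epsilon>" by simp
    finally show "norm (c *\<^sub>R x \<theta> T - c *\<^sub>R f \<theta>) < \<epsilon>" .
  qed
qed

lemma approx_reachable_0: "approx_reachable T M h P (\<lambda>_. 0)"
  unfolding approx_reachable_def
  by (intro allI impI exI[of _ "\<lambda>_. 0"] exI[of _ "\<lambda>_ _. 0"]) (auto simp: solves_on_def)

lemma approx_reachable_sum:
  assumes "finite I" and "\<And>i. i \<in> I \<Longrightarrow> approx_reachable T M h P (f i)"
  shows "approx_reachable T M h P (\<lambda>\<theta>. \<Sum>i\<in>I. f i \<theta>)"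
  using assms by (induction I) (auto simp: approx_reachable_0 intro: approx_reachable_add)

text \<open>The induction on the order of the derivative treats all times in \<open>{0..<T}\<close>
  at once, since a difference quotient at \<open>t\<close> uses the previous order at
  \<open>t + d\<close> too. The common bound on the matrices makes these quotients converge
  uniformly on \<open>P\<close>.\<close>

proposition approx_reachable_krylov:
  fixes M :: "'p \<Rightarrow> real ^ 'k ^ 'k"
  assumes M: "\<And>\<theta> v. \<theta> \<in> P \<Longrightarrow> norm (M \<theta> *v v) \<le> K * norm v" and T: "T > 0"
  shows "approx_reachable T M h P (\<lambda>\<theta>. ((*v) (M \<theta>) ^^ j) h)"
proof -
  \<comment> \<open>The bound on the step response coefficients requires a constant of at least
    1.\<close>
  define L where "L = max K 1"
  have L: "1 \<le> L"
    by (simp add: L_def)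
  have M_le: "norm (M \<theta> *v v) \<le> L * norm v" if "\<theta> \<in> P" for \<theta> v
    using M[OF that, of v] unfolding L_def
    by (rule order_trans) (intro mult_right_mono, auto)
  define a where "a = (\<lambda>\<theta>. step_response (M \<theta>) h)"
  have a: "norm (a \<theta> (k + j)) \<le> (norm h * L ^ j) * L ^ k" if "\<theta> \<in> P" for \<theta> j k
    unfolding a_def by (rule norm_shift_le[OF norm_step_response_le[OF M_le[OF that] L]])
  have "\<forall>t\<in>{0..<T}. approx_reachable T M h P (\<lambda>\<theta>. exp_series (\<lambda>k. a \<theta> (k + j)) t)" for j
  proof (induction j)
    case 0
    show ?case
    proof
      fix t assume t: "t \<in> {0..<T}"
      show "approx_reachable T M h P (\<lambda>\<theta>. exp_series (\<lambda>k. a \<theta> (k + 0)) t)"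
        unfolding approx_reachable_def
      proof (intro allI impI exI conjI ballI)
        \<comment> \<open>Switched on at \<open>T - t\<close>, the unit input has acted for a
          duration \<open>t\<close> at the final time, so the state reached is the step response at
          \<open>t\<close>.\<close>
        show "(indicator {T - t..} :: real \<Rightarrow> real) absolutely_integrable_on {0..T}"
        proof -
          have "emeasure lebesgue ({0..T} \<inter> {T - t..}) \<le> emeasure lebesgue {0..T}"
            by (rule emeasure_mono) auto
          also have "\<dots> < \<infinity>"
            by (simp add: emeasure_lborel_Icc_eq)
          finally show ?thesis
            unfolding set_integrable_def
            by (simp add: indicator_inter_arith[symmetric])
        qed
        fix \<theta> assume "\<theta> \<in> P"
        show "solves_on T (M \<theta>) h 0 (indicator {T - t..})
            (\<lambda>s. exp_series (a \<theta>) (max 0 (s - (T - t))))"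
          unfolding a_def using t by (intro solves_on_step[OF M_le[OF \<open>\<theta> \<in> P\<close>] L]) auto
      qed (use t in auto)
    qed
  next
    case (Suc j)
    show ?case
    proof
      fix t assume t: "t \<in> {0..<T}"
      define B where "B = norm h * L ^ j * L ^ 2 * exp (T * L)"
      have B: "B \<ge> 0"
        using L by (simp add: B_def)
      show "approx_reachable T M h P (\<lambda>\<theta>. exp_series (\<lambda>k. a \<theta> (k + Suc j)) t)"
      proof (rule approx_reachable_closed)
        fix \<epsilon> :: real assume "\<epsilon> > 0"
        \<comment> \<open>The first bound keeps \<open>t + d\<close> below \<open>T\<close>; the
          second makes the error \<open>d * B\<close> of the difference quotient smaller than
          \<open>\<epsilon>\<close>, where \<open>B + 1\<close> avoids division by zero.\<close>
        define d where "d = min ((T - t) / 2) (\<epsilon> / (2 * (B + 1)))"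
        have "0 < \<epsilon> / (2 * (B + 1))" "d \<le> (T - t) / 2"
          unfolding d_def using \<open>\<epsilon> > 0\<close> B by (simp, intro min.cobounded1)
        then have d: "0 < d" "t + d < T"
          using t by (auto simp: d_def)
        have "d * B \<le> \<epsilon> / (2 * (B + 1)) * (B + 1)"
          using B \<open>\<epsilon> > 0\<close> by (intro mult_mono) (auto simp: d_def)
        also have "\<dots> = \<epsilon> / 2"
          using B by (simp add: divide_simps)
        finally have dB: "d * B < \<epsilon>"
          using \<open>\<epsilon> > 0\<close> by simp
        let ?G = "\<lambda>\<theta> s. exp_series (\<lambda>k. a \<theta> (k + j)) s"
        have "approx_reachable T M h P (\<lambda>\<theta>. (1 / d) *\<^sub>R (?G \<theta> (t + d) + (- 1) *\<^sub>R ?G \<theta> t))"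
          using Suc.IH t d by (intro approx_reachable_scaleR approx_reachable_add) auto
        moreover have "norm ((1 / d) *\<^sub>R (?G \<theta> (t + d) + (- 1) *\<^sub>R ?G \<theta> t) -
            exp_series (\<lambda>k. a \<theta> (k + Suc j)) t) < \<epsilon>" if "\<theta> \<in> P" for \<theta>
          using exp_series_difference_quotient[OF a[OF that, of _ j], of t d T] d t dB
          by (simp add: B_def)
        ultimately show "\<exists>g. approx_reachable T M h P g \<and>
            (\<forall>\<theta>\<in>P. norm (g \<theta> - exp_series (\<lambda>k. a \<theta> (k + Suc j)) t) < \<epsilon>)"
          by blast
      qed
    qed
  qed
  \<comment> \<open>At time 0 the series reduces to its leading coefficient, and the step response
    has \<open>M^j h\<close> at index \<open>Suc j\<close>.\<close>
  from bspec[OF this[of "Suc j"], of 0] T show ?thesis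
    by (simp add: a_def step_response_def)
qed

section \<open>Continuous dependence of the free motion on the parameter\<close>

lemma continuous_on_matrix_vector_mult_parametric:
  fixes M :: "'p::topological_space \<Rightarrow> real ^ 'k ^ 'l" and v :: "'p \<Rightarrow> real ^ 'k"
  assumes "\<And>i j. continuous_on S (\<lambda>\<theta>. M \<theta> $ i $ j)" and "continuous_on S v"
  shows "continuous_on S (\<lambda>\<theta>. M \<theta> *v v \<theta>)"
  unfolding matrix_vector_mult_def
  by (intro continuous_on_vec_lambda continuous_intros assms)

text \<open>The partial sums are polynomial in the matrix entries and converge uniformly on
  \<open>P\<close> by the M-test. This allows the free motion to be subtracted from a continuous
  target.\<close>

lemma continuous_on_exp_series_iterate:
  fixes M :: "'p::topological_space \<Rightarrow> real ^ 'k ^ 'k"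
  assumes M: "\<And>\<theta> v. \<theta> \<in> P \<Longrightarrow> norm (M \<theta> *v v) \<le> K * norm v" and K: "0 \<le> K"
    and cont: "\<And>i j. continuous_on P (\<lambda>\<theta>. M \<theta> $ i $ j)"
  shows "continuous_on P (\<lambda>\<theta>. exp_series (\<lambda>k. ((*v) (M \<theta>) ^^ k) v) t)"
proof -
  let ?f = "\<lambda>k \<theta>. ((*v) (M \<theta>) ^^ k) v"
  have "continuous_on P (?f k)" for k
    by (induction k) (simp_all add: continuous_on_matrix_vector_mult_parametric cont)
  then have "continuous_on P (\<lambda>\<theta>. \<Sum>k<n. (t ^ k / fact k) *\<^sub>R ?f k \<theta>)" for n
    by (intro continuous_on_sum continuous_on_scaleR continuous_on_const)
  moreover have "uniform_limit P (\<lambda>n \<theta>. \<Sum>k<n. (t ^ k / fact k) *\<^sub>R ?f k \<theta>)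
      (\<lambda>\<theta>. exp_series (\<lambda>k. ?f k \<theta>) t) sequentially"
    unfolding exp_series_def
  proof (rule Weierstrass_m_test[OF _ summable_exp_real])
    fix k \<theta> assume "\<theta> \<in> P"
    show "norm ((t ^ k / fact k) *\<^sub>R ?f k \<theta>) \<le> norm v * ((\<bar>t\<bar> * K) ^ k / fact k)"
      by (rule exp_series_term_bound[OF norm_iterate_le[OF M[OF \<open>\<theta> \<in> P\<close>] K] order_refl])
  qed
  ultimately show ?thesis
    by (intro uniform_limit_theorem[OF always_eventually]) auto
qed

section \<open>The ring system matrix and its action on basis vectors\<close>

abbreviation ring_matrix :: "('n::finite \<Rightarrow> nat) \<Rightarrow> real \<Rightarrow> real ^ ('n \<times> 2) ^ ('n \<times> 2)" where
  "ring_matrix idx \<theta> \<equiv> network_matrix osc_A osc_b osc_c (K_ring idx \<theta>)"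

lemma ring_matrix_nth:
  "ring_matrix idx \<theta> $ (i, r) $ (j, s) =
     (if i = j then osc_A $ r $ s else 0)
     + (if [idx j = idx i + 1] (mod CARD('n)) then \<theta> else 0) * (osc_b $ r * osc_c $ s)"
  for idx :: "'n::finite \<Rightarrow> nat"
  by (simp add: network_matrix_def kron_mat_def mat_def K_ring_def matrix_matrix_mult_def
      columnvector_def rowvector_def)

lemma osc_nth [simp]:
  "osc_A $ 1 $ 1 = 0" "osc_A $ 1 $ 2 = - 1" "osc_A $ 2 $ 1 = 1" "osc_A $ 2 $ 2 = 0"
  "osc_b $ 1 = 1" "osc_b $ 2 = 0" "osc_c $ 1 = 0" "osc_c $ 2 = 1"
  by (simp_all add: osc_A_def osc_b_def osc_c_def vector_2)

lemma continuous_on_ring_matrix: "continuous_on S (\<lambda>\<theta>. ring_matrix idx \<theta> $ p $ q)"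
proof -
  obtain i r j s where pq: "p = (i, r)" "q = (j, s)"
    by (cases p; cases q) auto
  show ?thesis
    unfolding pq ring_matrix_nth
    by (cases "[idx j = idx i + 1] (mod CARD('a))") (simp_all add: continuous_intros)
qed

text \<open>Entries of \<open>osc_A\<close> and of the product of \<open>osc_b\<close> and
  \<open>osc_c\<close> have modulus at most 1, so every entry of the system matrix is at most
  \<open>1 + B\<close>. What matters is a constant common to all parameters in a bounded
  set.\<close>

lemma norm_ring_matrix_le:
  fixes idx :: "'n::finite \<Rightarrow> nat"
  assumes "\<bar>\<theta>\<bar> \<le> B"
  shows "norm (ring_matrix idx \<theta> *v v) \<le>
    real CARD('n \<times> 2) * real CARD('n \<times> 2) * (1 + B) * norm v"
proof -
  have "\<bar>ring_matrix idx \<theta> $ p $ q\<bar> \<le> 1 + B" for p q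
  proof -
    obtain i r j s where pq: "p = (i, r)" "q = (j, s)"
      by (cases p; cases q) auto
    show ?thesis
      unfolding pq using assms exhaust_2[of r] exhaust_2[of s] by (auto simp: ring_matrix_nth)
  qed
  then have "onorm ((*v) (ring_matrix idx \<theta>)) \<le> real CARD('n \<times> 2) * real CARD('n \<times> 2) * (1 + B)"
    by (rule onorm_le_matrix_component)
  then show ?thesis
    using onorm[OF matrix_vector_mul_bounded_linear, of "ring_matrix idx \<theta>" v]
    by (meson mult_right_mono norm_ge_zero order_trans)
qed

context
  fixes idx :: "'n::finite \<Rightarrow> nat"
  assumes idx: "bij_betw idx UNIV {1..CARD('n)}"
begin

lemma idx_cong_eq:
  assumes "[idx i = idx j] (mod CARD('n))"
  shows "i = j"
proof -
  have range: "idx i \<in> {1..CARD('n)}" "idx j \<in> {1..CARD('n)}"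
    using idx by (auto simp: bij_betw_def)
  \<comment> \<open>Lowering the numbering by one places it in the least residues 0 to N-1, where
    congruence implies equality.\<close>
  have "[idx i - 1 = idx j - 1] (mod CARD('n))"
    using assms range
    by (metis atLeastAtMost_iff cong_add_rcancel_nat le_add_diff_inverse2)
  then have "idx i - 1 = idx j - 1"
    using range by (intro cong_less_modulus_unique_nat) auto
  then have "idx i = idx j"
    using range by auto
  then show ?thesis
    using idx by (auto simp: bij_betw_def inj_on_def)
qed

lemma ex_idx_cong: "\<exists>i. [idx i = m] (mod CARD('n))"
proof -
  \<comment> \<open>This is the representative of \<open>m\<close> between 1 and N. Adding N-1 plays
    the role of subtracting 1 and avoids truncated subtraction at \<open>m = 0\<close>.\<close>
  define r where "r = (m + (CARD('n) - 1)) mod CARD('n) + 1"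
  have "0 < CARD('n)" by simp
  then have "r \<in> {1..CARD('n)}"
    unfolding r_def by (auto simp: Suc_le_eq)
  then obtain i where "idx i = r"
    using idx unfolding bij_betw_def by (metis imageE)
  moreover have "[r = m + (CARD('n) - 1) + 1] (mod CARD('n))"
    unfolding r_def by (intro cong_add) (auto simp: cong_def)
  moreover have "m + (CARD('n) - 1) + 1 = m + CARD('n)"
    using \<open>0 < CARD('n)\<close> by linarith
  ultimately show ?thesis
    by (auto simp: cong_def)
qed

lemma e_first_kron_b:
  assumes "[idx i = 1] (mod CARD('n))"
  shows "e_first idx \<otimes>\<^sub>V osc_b = axis (i, 1) 1"
proof -
  have "1 \<in> {1..CARD('n)}"
    by (auto simp: Suc_le_eq)
  then obtain i' where "idx i' = 1"
    using idx unfolding bij_betw_def by (metis imageE)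
  then have "idx i = 1"
    using idx_cong_eq[of i i'] assms by simp
  then have "idx j = 1 \<longleftrightarrow> j = i" for j
    using idx by (auto simp: bij_betw_def inj_on_def)
  moreover have "osc_b $ s = (if s = 1 then 1 else 0)" for s
    using exhaust_2[of s] by auto
  ultimately show ?thesis
    by (auto simp: kron_vec_def e_first_def axis_def vec_eq_iff)
qed

text \<open>The coupling reads only the second component of a node, so on a first component just the
  local rotation acts.\<close>

lemma ring_matrix_axis_1: "ring_matrix idx \<theta> *v axis (j, 1) 1 = axis (j, 2) 1"
proof -
  have "ring_matrix idx \<theta> $ (i, r) $ (j, 1) = axis (j, 2) 1 $ (i, r)" for i and r :: 2
    using exhaust_2[of r] by (auto simp: ring_matrix_nth axis_def)
  then show ?thesis
    by (simp add: matrix_vector_mult_basis column_def vec_eq_iff split_paired_all)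
qed

text \<open>Node \<open>j\<close> feeds exactly one node, its predecessor \<open>i\<close>, so the
  column contains a single coupling entry besides the local -1. For N = 1 both fall on the same
  entry and add up.\<close>

lemma ring_matrix_axis_2:
  assumes "[idx j = idx i + 1] (mod CARD('n))"
  shows "ring_matrix idx \<theta> *v axis (j, 2) 1 = \<theta> *\<^sub>R axis (i, 1) 1 - axis (j, 1) 1"
proof -
  have "i' = i" if "[idx j = idx i' + 1] (mod CARD('n))" for i'
  proof (rule idx_cong_eq)
    have "[idx i' + 1 = idx i + 1] (mod CARD('n))"
      by (rule cong_trans[OF cong_sym[OF that] assms])
    then show "[idx i' = idx i] (mod CARD('n))"
      by (simp only: cong_add_rcancel_nat)
  qed
  with assms have iff: "[idx j = idx i' + 1] (mod CARD('n)) \<longleftrightarrow> i' = i" for i'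
    by blast
  have "ring_matrix idx \<theta> $ (i', r) $ (j, 2) =
      (\<theta> *\<^sub>R axis (i, 1) 1 - axis (j, 1) 1) $ (i', r)" for i' and r :: 2
    unfolding ring_matrix_nth iff using exhaust_2[of r] by (auto simp: axis_def)
  then have "column (j, 2) (ring_matrix idx \<theta>) = \<theta> *\<^sub>R axis (i, 1) 1 - axis (j, 1) 1"
    unfolding vec_eq_iff split_paired_All by (simp only: column_def vec_lambda_beta) simp
  then show ?thesis
    by (simp only: matrix_vector_mult_basis)
qed

text \<open>Each local oscillator satisfies \<open>A^2 = -I\<close>; adding the identity cancels the
  local motion, leaving only the shift to the predecessor with weight \<open>\<theta>\<close>, in
  the same component \<open>s\<close>.\<close>

lemma ring_matrix_square:
  assumes "[idx j = idx i + 1] (mod CARD('n))"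
  shows "ring_matrix idx \<theta> *v (ring_matrix idx \<theta> *v axis (j, s) 1) + axis (j, s) 1
    = \<theta> *\<^sub>R axis (i, s) 1"
  using exhaust_2[of s]
  by (auto simp: ring_matrix_axis_1 ring_matrix_axis_2[OF assms] matrix_vector_mult_diff_distrib
      matrix_scaleR_vector_ac simp flip: scaleR_matrix_vector_assoc)

end

section \<open>From iterated shifts around the ring to all continuous families\<close>

text \<open>Demanding all powers at once builds in invariance under multiplication by
  \<open>M \<theta>\<close>, which the induction around the ring uses.\<close>

definition krylov_reachable ::
    "real \<Rightarrow> ('p \<Rightarrow> real ^ 'k ^ 'k) \<Rightarrow> real ^ 'k \<Rightarrow> 'p set \<Rightarrow> ('p \<Rightarrow> real ^ 'k) \<Rightarrow> bool" where
  "krylov_reachable T M h P f \<longleftrightarrow>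
     (\<forall>j. approx_reachable T M h P (\<lambda>\<theta>. ((*v) (M \<theta>) ^^ j) (f \<theta>)))"

lemma krylov_reachable_imp_approx_reachable:
  assumes "krylov_reachable T M h P f"
  shows "approx_reachable T M h P f"
  using spec[OF assms[unfolded krylov_reachable_def], of 0] by simp

lemma krylov_reachable_matrix:
  assumes "krylov_reachable T M h P f"
  shows "krylov_reachable T M h P (\<lambda>\<theta>. M \<theta> *v f \<theta>)"
  unfolding krylov_reachable_def
proof
  fix j
  have "((*v) (M \<theta>) ^^ j) (M \<theta> *v f \<theta>) = ((*v) (M \<theta>) ^^ Suc j) (f \<theta>)" for \<theta>
    by (simp add: funpow_swap1)
  then show "approx_reachable T M h P (\<lambda>\<theta>. ((*v) (M \<theta>) ^^ j) (M \<theta> *v f \<theta>))"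
    using assms unfolding krylov_reachable_def by (simp only:)
qed

lemma krylov_reachable_add:
  assumes "krylov_reachable T M h P f" and "krylov_reachable T M h P g"
  shows "krylov_reachable T M h P (\<lambda>\<theta>. f \<theta> + g \<theta>)"
proof -
  have "((*v) A ^^ j) (x + y) = ((*v) A ^^ j) x + ((*v) A ^^ j) y" for A :: "real^'b^'b" and x y j
    by (induction j) (simp_all add: matrix_vector_right_distrib)
  then show ?thesis
    using assms unfolding krylov_reachable_def by (simp add: approx_reachable_add)
qed

text \<open>Node \<open>i\<close> lies \<open>k\<close> backward steps from the first node, full
  turns included. Each step is one application of \<open>M^2 + I\<close> and contributes one factor
  \<open>\<theta>\<close>.\<close>

lemma ring_krylov_reachable:
  fixes idx :: "'n::finite \<Rightarrow> nat"
  assumes idx: "bij_betw idx UNIV {1..CARD('n)}" and P: "bounded P" and T: "T > 0"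
    and "[idx i + k = 1] (mod CARD('n))"
  shows "krylov_reachable T (ring_matrix idx) (e_first idx \<otimes>\<^sub>V osc_b) P (\<lambda>\<theta>. \<theta> ^ k *\<^sub>R axis (i, s) 1)"
    (is "?R (\<lambda>\<theta>. \<theta> ^ k *\<^sub>R axis (i, s) 1)")
  using assms(4)
proof (induction k arbitrary: i)
  case 0
  obtain B where "\<And>\<theta>. \<theta> \<in> P \<Longrightarrow> norm \<theta> \<le> B"
    using P by (auto simp: bounded_iff)
  then have "?R (\<lambda>_. e_first idx \<otimes>\<^sub>V osc_b)"
    unfolding krylov_reachable_def
    by (intro allI approx_reachable_krylov[OF norm_ring_matrix_le[of _ B] T]) auto
  moreover have e: "e_first idx \<otimes>\<^sub>V osc_b = axis (i, 1) 1"
    using 0 by (intro e_first_kron_b idx) simp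
  ultimately have "?R (\<lambda>_. axis (i, 1) 1)"
    by simp
  moreover from krylov_reachable_matrix[OF this] have "?R (\<lambda>_. axis (i, 2) 1)"
    by (simp add: ring_matrix_axis_1[OF idx])
  ultimately show ?case
    using exhaust_2[of s] by auto
next
  case (Suc k)
  \<comment> \<open>The successor \<open>j\<close> of \<open>i\<close> is one step closer to the
    first node, so the induction hypothesis applies to it with \<open>k\<close>.\<close>
  obtain j where j: "[idx j = idx i + 1] (mod CARD('n))"
    using ex_idx_cong[OF idx] by blast
  then have "[idx j + k = 1] (mod CARD('n))"
    using Suc.prems cong_add[OF j cong_refl[of k]] by (auto intro: cong_trans)
  then have R: "?R (\<lambda>\<theta>. \<theta> ^ k *\<^sub>R axis (j, s) 1)"
    by (rule Suc.IH)
  have "ring_matrix idx \<theta> *v (ring_matrix idx \<theta> *v (\<theta> ^ k *\<^sub>R axis (j, s) 1)) + \<theta> ^ k *\<^sub>R axis (j, s) 1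
      = \<theta> ^ Suc k *\<^sub>R axis (i, s) 1" for \<theta>
  proof -
    have "ring_matrix idx \<theta> *v (ring_matrix idx \<theta> *v (\<theta> ^ k *\<^sub>R axis (j, s) 1)) + \<theta> ^ k *\<^sub>R axis (j, s) 1
      = \<theta> ^ k *\<^sub>R (ring_matrix idx \<theta> *v (ring_matrix idx \<theta> *v axis (j, s) 1) + axis (j, s) 1)"
      by (simp add: matrix_scaleR_vector_ac scaleR_add_right flip: scaleR_matrix_vector_assoc)
    then show ?thesis
      by (simp add: ring_matrix_square[OF idx j] mult.commute)
  qed
  with krylov_reachable_add[OF krylov_reachable_matrix[OF krylov_reachable_matrix[OF R]] R]
  show ?case
    by simp
qed

lemma ring_approx_reachable_axis:
  fixes idx :: "'n::finite \<Rightarrow> nat"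
  assumes idx: "bij_betw idx UNIV {1..CARD('n)}" and P: "compact P" "P \<subseteq> {0<..}" and T: "T > 0"
    and g: "continuous_on P g"
  shows "approx_reachable T (ring_matrix idx) (e_first idx \<otimes>\<^sub>V osc_b) P (\<lambda>\<theta>. g \<theta> *\<^sub>R axis (i, s) 1)"
    (is "approx_reachable T ?M ?h P _")
proof (rule approx_reachable_closed)
  let ?R = "approx_reachable T ?M ?h P"
  fix \<epsilon> :: real assume "\<epsilon> > 0"
  let ?N = "CARD('n)"
  \<comment> \<open>\<open>m\<close> backward steps lead from the first node to node
    \<open>i\<close>, and every further turn adds N steps. This gives the exponents
    \<open>m + N * l\<close>.\<close>
  define m where "m = ?N + 1 - idx i"
  have "idx i \<in> {1..?N}"
    using idx by (auto simp: bij_betw_def)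
  then have m: "idx i + m = ?N + 1"
    by (simp add: m_def)
  have "[idx i + (m + ?N * l) = 1] (mod ?N)" for l
  proof -
    have "idx i + (m + ?N * l) = 1 + ?N * (l + 1)"
      using m by simp
    then show ?thesis
      by (simp only: cong_def mod_mult_self2)
  qed
  from krylov_reachable_imp_approx_reachable
    [OF ring_krylov_reachable[OF idx compact_imp_bounded[OF P(1)] T this]]
  have pow: "?R (\<lambda>\<theta>. \<theta> ^ (m + ?N * l) *\<^sub>R axis (i, s) 1)" for l .
  obtain B where B: "\<And>\<theta>. \<theta> \<in> P \<Longrightarrow> norm \<theta> \<le> B" "B > 0"
    using compact_imp_bounded[OF P(1)] by (auto simp: bounded_pos)
  \<comment> \<open>Chosen so that \<open>g \<theta> = \<theta> ^ m * G (\<theta> ^ N)\<close> on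
    \<open>P\<close>. Positivity of \<open>P\<close> makes the root invert the power and keeps the
    denominator away from 0, so \<open>G\<close> is continuous.\<close>
  define G where "G = (\<lambda>y. g (root ?N y) / root ?N y ^ m)"
  have root: "root ?N (\<theta> ^ ?N) = \<theta>" if "\<theta> \<in> P" for \<theta>
    using that P(2) by (intro real_root_power_cancel) auto
  have "continuous_on ((\<lambda>\<theta>. \<theta> ^ ?N) ` P) G"
    unfolding G_def
    by (intro continuous_intros continuous_on_compose2[OF g]) (use P(2) root in \<open>auto simp: subset_iff\<close>)
  moreover have "compact ((\<lambda>\<theta>. \<theta> ^ ?N) ` P)"
    by (intro compact_continuous_image P continuous_intros)
  \<comment> \<open>The tolerance anticipates the later multiplication by
    \<open>\<theta> ^ m\<close>, which is at most \<open>B ^ m\<close>.\<close>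
  ultimately obtain p where p: "real_polynomial_function p"
    "\<And>y. y \<in> (\<lambda>\<theta>. \<theta> ^ ?N) ` P \<Longrightarrow> \<bar>G y - p y\<bar> < \<epsilon> / B ^ m"
    using Stone_Weierstrass_real_polynomial_function[of _ G "\<epsilon> / B ^ m"] \<open>\<epsilon> > 0\<close> B(2) by auto
  then obtain a n where p_eq: "p = (\<lambda>y. \<Sum>l\<le>n. a l * y ^ l)"
    by (auto simp: real_polynomial_function_iff_sum)
  have "?R (\<lambda>\<theta>. \<Sum>l\<le>n. a l *\<^sub>R (\<theta> ^ (m + ?N * l) *\<^sub>R axis (i, s) 1))"
    by (intro approx_reachable_sum approx_reachable_scaleR pow) simp
  also have "(\<lambda>\<theta>. \<Sum>l\<le>n. a l *\<^sub>R (\<theta> ^ (m + ?N * l) *\<^sub>R axis (i, s) 1)) =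
      (\<lambda>\<theta>. (\<theta> ^ m * p (\<theta> ^ ?N)) *\<^sub>R axis (i, s) 1)"
    unfolding p_eq power_add power_mult sum_distrib_left scaleR_sum_left by (simp add: mult_ac)
  finally have "?R (\<lambda>\<theta>. (\<theta> ^ m * p (\<theta> ^ ?N)) *\<^sub>R axis (i, s) 1)" .
  moreover have "norm ((\<theta> ^ m * p (\<theta> ^ ?N)) *\<^sub>R axis (i, s) 1 - g \<theta> *\<^sub>R (axis (i, s) 1 :: real ^ ('n \<times> 2))) < \<epsilon>"
    if "\<theta> \<in> P" for \<theta>
  proof -
    have \<theta>: "0 < \<theta>" "\<theta> \<le> B"
      using that P(2) B(1)[OF that] by auto
    have "norm ((\<theta> ^ m * p (\<theta> ^ ?N)) *\<^sub>R axis (i, s) 1 - g \<theta> *\<^sub>R (axis (i, s) 1 :: real ^ ('n \<times> 2)))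
        = \<bar>\<theta> ^ m * p (\<theta> ^ ?N) - g \<theta>\<bar>"
      by (simp flip: scaleR_diff_left)
    also have "\<theta> ^ m * p (\<theta> ^ ?N) - g \<theta> = - (\<theta> ^ m * (G (\<theta> ^ ?N) - p (\<theta> ^ ?N)))"
      using \<theta> by (simp add: G_def root[OF that] algebra_simps)
    also have "\<bar>\<dots>\<bar> = \<theta> ^ m * \<bar>G (\<theta> ^ ?N) - p (\<theta> ^ ?N)\<bar>"
      using \<theta> by (simp add: abs_mult)
    also have "\<dots> < \<theta> ^ m * (\<epsilon> / B ^ m)"
      using \<theta> p(2)[of "\<theta> ^ ?N"] that by (intro mult_strict_left_mono) auto
    also have "\<dots> \<le> B ^ m * (\<epsilon> / B ^ m)"
      using \<theta> \<open>\<epsilon> > 0\<close> B(2) by (intro mult_right_mono power_mono) auto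
    also have "\<dots> = \<epsilon>"
      using B(2) by simp
    finally show ?thesis .
  qed
  ultimately show "\<exists>f. ?R f \<and> (\<forall>\<theta>\<in>P. norm (f \<theta> - g \<theta> *\<^sub>R axis (i, s) 1) < \<epsilon>)"
    by blast
qed

proposition ring_approx_reachable:
  fixes idx :: "'n::finite \<Rightarrow> nat"
  assumes "bij_betw idx UNIV {1..CARD('n)}" and "compact P" "P \<subseteq> {0<..}" and "T > 0"
    and f: "continuous_on P f"
  shows "approx_reachable T (ring_matrix idx) (e_first idx \<otimes>\<^sub>V osc_b) P f"
proof -
  have "approx_reachable T (ring_matrix idx) (e_first idx \<otimes>\<^sub>V osc_b) P
      (\<lambda>\<theta>. \<Sum>q\<in>UNIV. f \<theta> $ q *\<^sub>R axis q 1)"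
  proof (rule approx_reachable_sum)
    fix q :: "'n \<times> 2"
    have "continuous_on P (\<lambda>\<theta>. f \<theta> $ q)"
      using f by (intro continuous_intros)
    then show "approx_reachable T (ring_matrix idx) (e_first idx \<otimes>\<^sub>V osc_b) P
        (\<lambda>\<theta>. f \<theta> $ q *\<^sub>R axis q 1)"
      using assms by (cases q) (auto intro: ring_approx_reachable_axis)
  qed simp
  then show ?thesis
    using basis_expansion[of "f _"] by (simp add: scalar_mult_eq_scaleR)
qed

section \<open>Steering from an arbitrary initial state\<close>

theorem proposition3:
  fixes P :: "real set"
    and idx :: "'n::finite \<Rightarrow> nat"
    and xstar :: "real \<Rightarrow> real ^ 2"
    and x0 :: "real ^ ('n \<times> 2)"
  assumes "compact P" and "is_interval P" and "closure (interior P) = P" and "P \<noteq> {}"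
    and "P \<subseteq> {0<..<1} \<union> {1<..}"
    and "bij_betw idx UNIV {1..CARD('n)}"
    and "continuous_on P xstar"
  shows "robustly_synchronizable P osc_A osc_b osc_c (K_ring idx) (e_first idx) x0 xstar"
  unfolding robustly_synchronizable_def
proof (intro allI impI)
  fix \<epsilon> :: real assume "\<epsilon> > 0"
  let ?M = "ring_matrix idx" and ?h = "e_first idx \<otimes>\<^sub>V osc_b"
  define y where "y = (\<lambda>\<theta>. exp_series (\<lambda>k. ((*v) (?M \<theta>) ^^ k) x0))"
  obtain B where B: "\<And>\<theta>. \<theta> \<in> P \<Longrightarrow> norm \<theta> \<le> B" "B > 0"
    using compact_imp_bounded[OF \<open>compact P\<close>] by (auto simp: bounded_pos)
  define K where "K = real CARD('n \<times> 2) * real CARD('n \<times> 2) * (1 + B)"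
  have M: "norm (?M \<theta> *v v) \<le> K * norm v" if "\<theta> \<in> P" for \<theta> v
    unfolding K_def using B(1)[OF that] by (intro norm_ring_matrix_le) simp
  have K: "0 \<le> K"
    using B(2) by (simp add: K_def)
  have y: "solves_on 1 (?M \<theta>) ?h x0 (\<lambda>_. 0) (y \<theta>)" if "\<theta> \<in> P" for \<theta>
    unfolding y_def by (rule solves_on_free[OF M[OF that] K])
  have "continuous_on P (\<lambda>\<theta>. y \<theta> 1)"
    unfolding y_def by (rule continuous_on_exp_series_iterate[OF M K continuous_on_ring_matrix])
  moreover have "continuous_on P (\<lambda>\<theta>. (1 :: real ^ 'n) \<otimes>\<^sub>V xstar \<theta>)"
    unfolding kron_vec_def
    by (intro continuous_on_vec_lambda continuous_intros \<open>continuous_on P xstar\<close>)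
  \<comment> \<open>By linearity it suffices to steer from rest to the target minus the free motion
    from \<open>x0\<close>. The final time 1 is an arbitrary positive choice.\<close>
  ultimately have "approx_reachable 1 ?M ?h P (\<lambda>\<theta>. 1 \<otimes>\<^sub>V xstar \<theta> - y \<theta> 1)"
    using assms by (intro ring_approx_reachable continuous_intros) auto
  then obtain u x where u: "u absolutely_integrable_on {0..1}"
    and x: "\<And>\<theta>. \<theta> \<in> P \<Longrightarrow> solves_on 1 (?M \<theta>) ?h 0 u (x \<theta>)"
    and lim: "\<And>\<theta>. \<theta> \<in> P \<Longrightarrow> norm (x \<theta> 1 - (1 \<otimes>\<^sub>V xstar \<theta> - y \<theta> 1)) < \<epsilon> / 2"
    using \<open>\<epsilon> > 0\<close> by (elim approx_reachableE[where \<epsilon> = "\<epsilon> / 2"]) auto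
  let ?z = "\<lambda>\<theta> s. x \<theta> s + y \<theta> s"
  have z: "\<forall>\<theta>\<in>P. solves_on 1 (?M \<theta>) ?h x0 u (?z \<theta>)"
    using solves_on_add[OF x y] by simp
  \<comment> \<open>Pointwise bounds below \<open>\<epsilon>\<close> would only give a supremum of
    at most \<open>\<epsilon>\<close>; halving the tolerance keeps the final inequality
    strict.\<close>
  have le: "norm (?z \<theta> 1 - 1 \<otimes>\<^sub>V xstar \<theta>) \<le> \<epsilon> / 2" if "\<theta> \<in> P" for \<theta>
    using lim[OF that] by (simp add: algebra_simps)
  have "bdd_above ((\<lambda>\<theta>. norm (?z \<theta> 1 - 1 \<otimes>\<^sub>V xstar \<theta>)) ` P)"
    using le by (rule bdd_aboveI2)
  moreover have "(SUP \<theta>\<in>P. norm (?z \<theta> 1 - 1 \<otimes>\<^sub>V xstar \<theta>)) \<le> \<epsilon> / 2"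
    using le \<open>P \<noteq> {}\<close> by (intro cSUP_least)
  ultimately show "\<exists>T>0. \<exists>u. u absolutely_integrable_on {0..T} \<and>
      (\<exists>x. (\<forall>\<theta>\<in>P. solves_on T (?M \<theta>) ?h x0 u (x \<theta>)) \<and>
        bdd_above ((\<lambda>\<theta>. norm (x \<theta> T - 1 \<otimes>\<^sub>V xstar \<theta>)) ` P) \<and>
        (SUP \<theta>\<in>P. norm (x \<theta> T - 1 \<otimes>\<^sub>V xstar \<theta>)) < \<epsilon>)"
    using z u \<open>\<epsilon> > 0\<close>
    by (intro exI[of _ 1] conjI exI[of _ u] exI[of _ ?z]) auto
qed

end
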